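(* Let $X\neq\{0\}$ be a real Hilbert space, let $\tau>0$, $c\in X$, $w\in X$, $\beta\in\mathbb{R}$, and let $E:X\to X$ be an invertible and continuous linear operator. Consider the fixed point equation, with unknown $f:X\to[-\infty,\infty]$, $$(\star)\qquad f(x)=\tau f^*(Ex+c)+\langle w,x\rangle+\beta,\quad x\in X.$$ Then the following hold. (a) Any solution $f:X\to[-\infty,\infty]$ of $(\star)$ is proper, convex and lower semicontinuous. (b) If $E$ is positive definite, then there exists a strictly convex quadratic solution $f:X\to\mathbb{R}$ of $(\star)$, of the form $f(x)=\frac12\langle Ax,x\rangle+\langle b,x\rangle+\gamma$, $x\in X$, whose coefficients satisfy $$A=\sqrt{\tau}\,E,\qquad b=\frac{w+\sqrt{\tau}\,c}{1+\sqrt{\tau}},\qquad \gamma=\frac{\beta(1+\sqrt{\tau})^2+\frac12\sqrt{\tau}\,\langle c-w,E^{-1}(c-w)\rangle}{(1+\sqrt{\tau})^2(\tau+1)}.\qquad(\star\star)$$ This solution is the unique solution of $(\star)$ in the class of quadratic functions having a leading coefficient which is invertible. (c) Suppose that $E$ is positive definite. (i) If $\tau=1$ and $c=w$, then $(\star)$ has a unique solution in the class of all functions from $X$ to $[-\infty,\infty]$. (ii) If $X$ is finite dimensional and $\tau\neq1$, then $(\star)$ has a unique solution in the class of functions $f:X\to\mathbb{R}$ which are twice differentiable and whose second derivative is continuous at the point $x_0:=\frac{1}{1-\tau}(E^{-1}w-E^{-1}c)$. In both cases this unique solution is quadratic and strictly convex and its coefficients satisfy $(\star\star)$. (d) If $E$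 is not positive definite, then, depending on $E$ and on the other parameters, each of the following situations occurs: there are choices of $X$, $E$ (invertible, continuous, linear, not positive definite), $\tau,c,w,\beta$ for which $(\star)$ has no solution $f:X\to[-\infty,\infty]$; there are such choices for which $(\star)$ has at least one solution; and there are such choices for which $(\star)$ has several solutions (and even infinitely many), some of which are not quadratic.
   Context: For $f:X\to[-\infty,\infty]$, the Legendre-Fenchel transform is $f^*(x^* ):=\sup\{\langle x^*,x\rangle-f(x):x\in X\}$, $x^*\in X$. A function $f:X\to[-\infty,\infty]$ is proper if $f(x)>-\infty$ for all $x\in X$ and $f(x)\neq\infty$ for at least one $x\in X$. A continuous linear operator $A:X\to X$ is positive definite if it is self-adjoint and $\langle Ax,x\rangle>0$ for all $0\neq x\in X$. A function $f$ is quadratic if $f(x)=\frac12\langle Ax,x\rangle+\langle b,x\rangle+\gamma$ for all $x\in X$, for some continuous self-adjoint linear operator $A:X\to X$ with $A\neq0$, some $b\in X$ and some $\gamma\in\mathbb{R}$; $A$ is called the leading coefficient of $f$. Differentiability is in the Fréchet sense; twice differentiable means twice differentiable at every point of $X$, and $f''(x)$ is identified with a continuous self-adjoint linear operator on $X$. *)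

theory Defs
  imports "HOL-Analysis.Analysis"
begin

text \<open>
  A real Hilbert space is a type of sort \<open>{real_inner, complete_space}\<close>, a continuous linear
  operator on it has type \<open>'a \<Rightarrow>\<^sub>L 'a\<close>, and a function with values in $[-\infty,\infty]$
  has type \<open>'a \<Rightarrow> ereal\<close>. An operator is invertible if it is bijective; by the bounded inverse
  theorem the inverse is then continuous.
\<close>

definition legendre :: "('a::real_inner \<Rightarrow> ereal) \<Rightarrow> 'a \<Rightarrow> ereal" where
  "legendre f y = (SUP x. ereal (y \<bullet> x) - f x)"

definition solves_star ::
  "real \<Rightarrow> ('a::real_inner \<Rightarrow>\<^sub>L 'a) \<Rightarrow> 'a \<Rightarrow> 'a \<Rightarrow> real \<Rightarrow> ('a \<Rightarrow> ereal) \<Rightarrow> bool" where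
  "solves_star \<tau> E c w \<beta> f \<longleftrightarrow>
     (\<forall>x. f x = ereal \<tau> * legendre f (blinfun_apply E x + c) + ereal (w \<bullet> x) + ereal \<beta>)"

definition proper_fun :: "('a \<Rightarrow> ereal) \<Rightarrow> bool" where
  "proper_fun f \<longleftrightarrow> (\<forall>x. f x > -\<infinity>) \<and> (\<exists>x. f x \<noteq> \<infinity>)"

text \<open>
  In \<^typ>\<open>ereal\<close> one has \<open>\<infinity> + (-\<infinity>) = \<infinity>\<close>, so for arbitrary extended-valued functions the
  inequality below is equivalent to convexity of the epigraph.
\<close>

definition convex_fun :: "('a::real_vector \<Rightarrow> ereal) \<Rightarrow> bool" where
  "convex_fun f \<longleftrightarrow> (\<forall>x y t. 0 < t \<and> t < 1 \<longrightarrow>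
     f ((1 - t) *\<^sub>R x + t *\<^sub>R y) \<le> ereal (1 - t) * f x + ereal t * f y)"

definition lsc_fun :: "('a::topological_space \<Rightarrow> ereal) \<Rightarrow> bool" where
  "lsc_fun f \<longleftrightarrow> (\<forall>x. f x \<le> Liminf (at x) f)"

definition strictly_convex_fun :: "('a::real_vector \<Rightarrow> real) \<Rightarrow> bool" where
  "strictly_convex_fun f \<longleftrightarrow> (\<forall>x y t. x \<noteq> y \<and> 0 < t \<and> t < 1 \<longrightarrow>
     f ((1 - t) *\<^sub>R x + t *\<^sub>R y) < (1 - t) * f x + t * f y)"

definition self_adjoint :: "('a::real_inner \<Rightarrow>\<^sub>L 'a) \<Rightarrow> bool" where
  "self_adjoint A \<longleftrightarrow> (\<forall>x y. blinfun_apply A x \<bullet> y = x \<bullet> blinfun_apply A y)"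

definition positive_definite :: "('a::real_inner \<Rightarrow>\<^sub>L 'a) \<Rightarrow> bool" where
  "positive_definite A \<longleftrightarrow> self_adjoint A \<and> (\<forall>x. x \<noteq> 0 \<longrightarrow> blinfun_apply A x \<bullet> x > 0)"

definition quadratic_with ::
  "('a::real_inner \<Rightarrow>\<^sub>L 'a) \<Rightarrow> 'a \<Rightarrow> real \<Rightarrow> ('a \<Rightarrow> real) \<Rightarrow> bool" where
  "quadratic_with A b \<gamma> f \<longleftrightarrow> self_adjoint A \<and> A \<noteq> 0 \<and>
     (\<forall>x. f x = 1 / 2 * (blinfun_apply A x \<bullet> x) + b \<bullet> x + \<gamma>)"

definition quadratic :: "('a::real_inner \<Rightarrow> real) \<Rightarrow> bool" where
  "quadratic f \<longleftrightarrow> (\<exists>A b \<gamma>. quadratic_with A b \<gamma> f)"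

definition quadratic_invertible :: "('a::real_inner \<Rightarrow> real) \<Rightarrow> bool" where
  "quadratic_invertible f \<longleftrightarrow> (\<exists>A b \<gamma>. quadratic_with A b \<gamma> f \<and> bij (blinfun_apply A))"

definition star_coefficients ::
  "real \<Rightarrow> ('a::real_inner \<Rightarrow>\<^sub>L 'a) \<Rightarrow> 'a \<Rightarrow> 'a \<Rightarrow> real \<Rightarrow>
   ('a \<Rightarrow>\<^sub>L 'a) \<Rightarrow> 'a \<Rightarrow> real \<Rightarrow> bool" where
  "star_coefficients \<tau> E c w \<beta> A b \<gamma> \<longleftrightarrow>
     A = sqrt \<tau> *\<^sub>R E \<and>
     b = (1 / (1 + sqrt \<tau>)) *\<^sub>R (w + sqrt \<tau> *\<^sub>R c) \<and>
     \<gamma> = (\<beta> * (1 + sqrt \<tau>)\<^sup>2 + 1 / 2 * sqrt \<tau> * ((c - w) \<bullet> inv (blinfun_apply E) (c - w)))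
         / ((1 + sqrt \<tau>)\<^sup>2 * (\<tau> + 1))"

text \<open>
  The Frechet derivative of \<open>f\<close> at \<open>x\<close> is identified with the gradient \<open>f' x\<close> by the Riesz
  theorem, and the second derivative with the operator \<open>f'' x\<close>; continuity of \<open>f''\<close> refers to the
  operator norm.
\<close>

definition twice_differentiable_cont_at :: "'a::real_inner \<Rightarrow> ('a \<Rightarrow> real) \<Rightarrow> bool" where
  "twice_differentiable_cont_at x0 f \<longleftrightarrow>
     (\<exists>(f' :: 'a \<Rightarrow> 'a) (f'' :: 'a \<Rightarrow> 'a \<Rightarrow>\<^sub>L 'a).
        (\<forall>x. GDERIV f x :> f' x) \<and>
        (\<forall>x. (f' has_derivative blinfun_apply (f'' x)) (at x)) \<and>
        isCont f'' x0)"

end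

theory Submission
  imports Defs
begin

text \<open>
  By (\<open>\<star>\<close>) a solution is a supremum of continuous affine functions, which gives (a). If a real
  solution \<open>f\<close> has gradient \<open>G\<close>, the Fenchel--Young equality shows that \<open>E z + c = G x\<close> implies
  \<open>G z = \<tau> E x + w\<close>. For an affine gradient \<open>A x + b\<close> this forces \<open>A = sqrt \<tau> E\<close> and determines
  \<open>b\<close> and \<open>f\<close>, which is the uniqueness in (b). For \<open>\<tau> \<noteq> 1\<close> it makes \<open>G\<close> equivariant under the
  homothety with centre \<open>x\<^sub>0\<close> and ratio \<open>\<tau>\<close>; so \<open>f''\<close> is invariant under it, and, being
  continuous at \<open>x\<^sub>0\<close>, it is constant. All examples in (d) have \<open>X = \<real>\<close>, \<open>E = -1\<close>, \<open>\<tau> = 1\<close>.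
\<close>

section \<open>Solutions as suprema of affine functions\<close>

lemma fenchel_young: "ereal (y \<bullet> x) - f x \<le> legendre f y"
  unfolding legendre_def by (rule SUP_upper) simp

lemma legendre_antimono:
  assumes "\<And>x. f x \<le> g x"
  shows "legendre g y \<le> legendre f y"
  unfolding legendre_def by (rule SUP_mono') (simp add: assms ereal_minus_mono)

lemma solves_starD:
  assumes "solves_star \<tau> E c w \<beta> f"
  shows "f x = ereal \<tau> * legendre f (blinfun_apply E x + c) + ereal (w \<bullet> x) + ereal \<beta>"
  using assms unfolding solves_star_def by blast

lemma proper_funD: "proper_fun f \<Longrightarrow> f x \<noteq> -\<infinity>"
  unfolding proper_fun_def by (metis less_irrefl)

text \<open>A value -infinity at \<open>a\<close> makes the conjugate +infinity everywhere, so the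
  equation returns +infinity at \<open>a\<close> itself. If \<open>f\<close> were identically
  +infinity, its conjugate would be -infinity, and so would \<open>f 0\<close>.\<close>

lemma solves_star_proper:
  assumes "solves_star \<tau> E c w \<beta> f" and "\<tau> > 0"
  shows "proper_fun f"
proof -
  have "f a \<noteq> -\<infinity>" for a
  proof
    assume a: "f a = -\<infinity>"
    have "legendre f (blinfun_apply E a + c) = \<infinity>"
      using fenchel_young[of "blinfun_apply E a + c" a f] a by simp
    then have "f a = \<infinity>"
      using solves_starD[OF assms(1), of a] assms(2) by simp
    with a show False by simp
  qed
  moreover have "\<exists>x. f x \<noteq> \<infinity>"
  proof (rule ccontr)
    assume "\<not> ?thesis"
    then have top: "f x = \<infinity>" for x by blast
    then have "legendre f y = -\<infinity>" for y
      by (simp add: legendre_def)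
    then have "f 0 = -\<infinity>"
      using solves_starD[OF assms(1), of 0] assms(2) by simp
    with top[of 0] show False by simp
  qed
  ultimately show ?thesis
    unfolding proper_fun_def by (metis less_ereal.simps(2) ereal_infty_less(2))
qed

lemma solves_star_eq_SUP:
  fixes E :: "'a::real_inner \<Rightarrow>\<^sub>L 'a"
  assumes sol: "solves_star \<tau> E c w \<beta> f" and tau: "\<tau> > 0"
  shows "f x = (SUP u\<in>{u. f u \<noteq> \<infinity>}.
    ereal (\<tau> * ((blinfun_apply E x + c) \<bullet> u - real_of_ereal (f u)) + w \<bullet> x + \<beta>))"
    (is "_ = (SUP u\<in>?D. ereal (?h u))")
proof (rule antisym)
  have pr: "proper_fun f" using solves_star_proper[OF sol tau] .
  have fin: "\<exists>r. f u = ereal r" if "u \<in> ?D" for u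
    using proper_funD[OF pr, of u] that by (cases "f u") auto
  show "(SUP u\<in>?D. ereal (?h u)) \<le> f x"
  proof (rule SUP_least)
    fix u assume "u \<in> ?D"
    then obtain r where r: "f u = ereal r" using fin by blast
    show "ereal (?h u) \<le> f x"
    proof (cases "legendre f (blinfun_apply E x + c)")
      case (real l)
      have "(blinfun_apply E x + c) \<bullet> u - r \<le> l"
        using fenchel_young[of "blinfun_apply E x + c" u f] real r by simp
      then show ?thesis
        using tau solves_starD[OF sol, of x] real r by (simp add: mult_left_mono)
    next
      case PInf
      then show ?thesis using tau solves_starD[OF sol, of x] by simp
    next
      case MInf
      then show ?thesis using fenchel_young[of "blinfun_apply E x + c" u f] r by simp
    qed
  qed
  show "f x \<le> (SUP u\<in>?D. ereal (?h u))"
  proof (cases "SUP u\<in>?D. ereal (?h u)")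
    case (real s)
    \<comment> \<open>With a finite supremum \<open>s\<close>, each bound by \<open>s\<close> is
      solved for its conjugate term, and the resulting bound on the conjugate is put back into the
      equation.\<close>
    have "legendre f (blinfun_apply E x + c) \<le> ereal ((s - w \<bullet> x - \<beta>) / \<tau>)"
      unfolding legendre_def
    proof (rule SUP_least)
      fix u
      show "ereal ((blinfun_apply E x + c) \<bullet> u) - f u \<le> ereal ((s - w \<bullet> x - \<beta>) / \<tau>)"
      proof (cases "f u = \<infinity>")
        case False
        then obtain r where r: "f u = ereal r" using fin by blast
        have "ereal (?h u) \<le> ereal s"
          unfolding real[symmetric] using False by (intro SUP_upper) simp
        then have "((blinfun_apply E x + c) \<bullet> u - r) * \<tau> \<le> s - w \<bullet> x - \<beta>"
          using r by (simp add: algebra_simps)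
        then show ?thesis using tau r by (simp add: pos_le_divide_eq)
      qed simp
    qed
    then have "ereal \<tau> * legendre f (blinfun_apply E x + c)
        \<le> ereal \<tau> * ereal ((s - w \<bullet> x - \<beta>) / \<tau>)"
      using tau by (intro ereal_mult_left_mono) auto
    then have "f x \<le> ereal \<tau> * ereal ((s - w \<bullet> x - \<beta>) / \<tau>) + ereal (w \<bullet> x) + ereal \<beta>"
      unfolding solves_starD[OF sol, of x] by (intro add_mono) auto
    then show ?thesis using real tau by simp
  next
    case MInf
    obtain u where "u \<in> ?D" using pr unfolding proper_fun_def by blast
    then have "ereal (?h u) \<le> -\<infinity>" unfolding MInf[symmetric] by (rule SUP_upper)
    then show ?thesis by simp
  qed simp
qed

lemma solves_star_convex:
  assumes sol: "solves_star \<tau> E c w \<beta> f" and tau: "\<tau> > 0"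
  shows "convex_fun f"
  unfolding convex_fun_def
proof (intro allI impI)
  fix x y :: 'a and t :: real
  assume t: "0 < t \<and> t < 1"
  let ?h = "\<lambda>u x. \<tau> * ((blinfun_apply E x + c) \<bullet> u - real_of_ereal (f u)) + w \<bullet> x + \<beta>"
  note eq = solves_star_eq_SUP[OF sol tau]
  show "f ((1 - t) *\<^sub>R x + t *\<^sub>R y) \<le> ereal (1 - t) * f x + ereal t * f y"
    unfolding eq[of "(1 - t) *\<^sub>R x + t *\<^sub>R y"]
  proof (rule SUP_least)
    fix u assume u: "u \<in> {u. f u \<noteq> \<infinity>}"
    have le: "ereal (?h u z) \<le> f z" for z
      unfolding eq[of z] using u by (rule SUP_upper)
    have "ereal (?h u ((1 - t) *\<^sub>R x + t *\<^sub>R y))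
        = ereal (1 - t) * ereal (?h u x) + ereal t * ereal (?h u y)"
      by (simp add: blinfun.bilinear_simps inner_simps algebra_simps)
    also have "\<dots> \<le> ereal (1 - t) * f x + ereal t * f y"
      using t le by (intro add_mono ereal_mult_left_mono) auto
    finally show "ereal (?h u ((1 - t) *\<^sub>R x + t *\<^sub>R y)) \<le> ereal (1 - t) * f x + ereal t * f y" .
  qed
qed

lemma solves_star_lsc:
  assumes sol: "solves_star \<tau> E c w \<beta> f" and tau: "\<tau> > 0"
  shows "lsc_fun f"
  unfolding lsc_fun_def le_Liminf_iff
proof (intro allI impI)
  fix x :: 'a and C assume "C < f x"
  let ?h = "\<lambda>u x. \<tau> * ((blinfun_apply E x + c) \<bullet> u - real_of_ereal (f u)) + w \<bullet> x + \<beta>"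
  note eq = solves_star_eq_SUP[OF sol tau]
  \<comment> \<open>A single affine minorant already exceeds \<open>C\<close> at \<open>x\<close>,
    and by continuity it does so near \<open>x\<close>.\<close>
  obtain u where u: "u \<in> {u. f u \<noteq> \<infinity>}" "C < ereal (?h u x)"
    using \<open>C < f x\<close> unfolding eq[of x] less_SUP_iff by blast
  have "((\<lambda>z. ereal (?h u z)) \<longlongrightarrow> ereal (?h u x)) (at x)"
    by (intro tendsto_intros)
  then have "\<forall>\<^sub>F z in at x. C < ereal (?h u z)"
    using u(2) by (rule order_tendstoD)
  then show "\<forall>\<^sub>F z in at x. C < f z"
  proof (rule eventually_mono)
    fix z assume "C < ereal (?h u z)"
    also have "\<dots> \<le> f z" unfolding eq[of z] using u(1) by (rule SUP_upper)
    finally show "C < f z" .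
  qed
qed

section \<open>Quadratic functions and their conjugates\<close>

lemma quadratic_with_expand:
  assumes "quadratic_with A b \<gamma> f"
  shows "f y = f x + (blinfun_apply A x + b) \<bullet> (y - x) + 1 / 2 * (blinfun_apply A (y - x) \<bullet> (y - x))"
proof -
  have "blinfun_apply A x \<bullet> y = blinfun_apply A y \<bullet> x"
    using assms unfolding quadratic_with_def self_adjoint_def by (metis inner_commute)
  then show ?thesis
    using assms unfolding quadratic_with_def
    by (simp add: blinfun.diff_right inner_simps algebra_simps)
qed

lemma GDERIV_quadratic_with:
  assumes "quadratic_with A b \<gamma> f"
  shows "GDERIV f x :> blinfun_apply A x + b"
proof -
  have f: "f = (\<lambda>x. 1 / 2 * (blinfun_apply A x \<bullet> x) + b \<bullet> x + \<gamma>)"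
    using assms unfolding quadratic_with_def by auto
  have sym: "x \<bullet> blinfun_apply A h = h \<bullet> blinfun_apply A x" for h
    using assms unfolding quadratic_with_def self_adjoint_def by (metis inner_commute)
  have "((\<lambda>x. 1 / 2 * (blinfun_apply A x \<bullet> x) + b \<bullet> x + \<gamma>) has_derivative
      (\<lambda>h. 1 / 2 * (blinfun_apply A x \<bullet> h + blinfun_apply A h \<bullet> x) + b \<bullet> h)) (at x)"
    by (auto intro!: derivative_eq_intros)
  moreover have "1 / 2 * (blinfun_apply A x \<bullet> h + blinfun_apply A h \<bullet> x) + b \<bullet> h
      = h \<bullet> (blinfun_apply A x + b)" for h
    using sym[of h] by (simp add: inner_add_right inner_commute)
  ultimately show ?thesis
    unfolding f gderiv_def by simp
qed

text \<open>The argument is the gradient at \<open>u\<close>, so the expansion of \<open>f\<close>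
  about \<open>u\<close> leaves only a nonnegative remainder: the supremum is attained at
  \<open>u\<close>.\<close>

lemma legendre_quadratic_with:
  assumes quad: "quadratic_with A b \<gamma> f"
    and nonneg: "\<And>v. 0 \<le> blinfun_apply A v \<bullet> v"
  shows "legendre (\<lambda>x. ereal (f x)) (blinfun_apply A u + b)
    = ereal (1 / 2 * (blinfun_apply A u \<bullet> u) - \<gamma>)"
proof -
  have fu: "(blinfun_apply A u + b) \<bullet> u - f u = 1 / 2 * (blinfun_apply A u \<bullet> u) - \<gamma>"
    using quad unfolding quadratic_with_def by (simp add: inner_simps)
  have "(blinfun_apply A u + b) \<bullet> x - f x \<le> 1 / 2 * (blinfun_apply A u \<bullet> u) - \<gamma>" for x
    using quadratic_with_expand[OF quad, of x u] nonneg[of "x - u"] fu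
    by (simp add: inner_simps algebra_simps)
  then show ?thesis
    unfolding legendre_def using fu by (intro antisym SUP_least SUP_upper2[of u]) auto
qed

lemma strictly_convex_quadratic_with:
  assumes quad: "quadratic_with A b \<gamma> f"
    and pos: "\<And>v. v \<noteq> 0 \<Longrightarrow> 0 < blinfun_apply A v \<bullet> v"
  shows "strictly_convex_fun f"
  unfolding strictly_convex_fun_def
proof (intro allI impI)
  fix x y :: 'a and t :: real
  assume xyt: "x \<noteq> y \<and> 0 < t \<and> t < 1"
  define z where "z = (1 - t) *\<^sub>R x + t *\<^sub>R y"
  have x: "x - z = t *\<^sub>R (x - y)" and y: "y - z = (t - 1) *\<^sub>R (x - y)"
    unfolding z_def by (simp_all add: algebra_simps)
  \<comment> \<open>Expanding about \<open>z\<close>, the linear terms cancel because the weighted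
    displacements of \<open>x\<close> and \<open>y\<close> from \<open>z\<close> add up to
    zero.\<close>
  have "(1 - t) * f x + t * f y - f z = 1 / 2 * (t * (1 - t) * (blinfun_apply A (x - y) \<bullet> (x - y)))"
    unfolding quadratic_with_expand[OF quad, of x z] quadratic_with_expand[OF quad, of y z] x y
      blinfun.scaleR_right inner_scaleR_left inner_scaleR_right
    by (simp add: field_simps)
  moreover have "0 < t * (1 - t) * (blinfun_apply A (x - y) \<bullet> (x - y))"
    using pos[of "x - y"] xyt by simp
  ultimately show "f ((1 - t) *\<^sub>R x + t *\<^sub>R y) < (1 - t) * f x + t * f y"
    unfolding z_def by simp
qed

section \<open>Existence of quadratic solutions and the self-conjugate case\<close>

lemma star_coefficients_solves_star:
  fixes E :: "'a::real_inner \<Rightarrow>\<^sub>L 'a"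
  assumes E: "positive_definite E" and bij: "bij (blinfun_apply E)" and tau: "\<tau> > 0"
    and quad: "quadratic_with A b \<gamma> f" and coeff: "star_coefficients \<tau> E c w \<beta> A b \<gamma>"
  shows "solves_star \<tau> E c w \<beta> (\<lambda>x. ereal (f x))"
  unfolding solves_star_def
proof
  fix x :: 'a
  define s where "s = sqrt \<tau>"
  \<comment> \<open>The vector \<open>e\<close> solves \<open>E e = c - b\<close>. Hence
    \<open>u\<close> solves \<open>A u + b = E x + c\<close>, that is, \<open>u\<close> is the point
    at which the supremum in the conjugate is attained.\<close>
  define e where "e = (1 / (1 + s)) *\<^sub>R inv (blinfun_apply E) (c - w)"
  define u where "u = (1 / s) *\<^sub>R (x + e)"
  have s: "s > 0" "\<tau> = s\<^sup>2" using tau by (auto simp: s_def)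
  have s1: "1 + s \<noteq> 0" "1 + s\<^sup>2 \<noteq> 0" using s(1) by (auto simp: add_nonneg_eq_0_iff)
  have A: "blinfun_apply A v = s *\<^sub>R blinfun_apply E v" for v
    using coeff unfolding star_coefficients_def s_def by (simp add: blinfun.scaleR_left)
  have b: "(1 + s) *\<^sub>R b = w + s *\<^sub>R c"
    using coeff s1 unfolding star_coefficients_def s_def[symmetric] by simp
  have inv: "blinfun_apply E (inv (blinfun_apply E) v) = v" for v
    using bij by (simp add: bij_is_surj surj_f_inv_f)
  have "(1 + s) *\<^sub>R (c - b) = c - w"
    using b by (simp add: algebra_simps)
  then have Ee: "blinfun_apply E e = c - b"
    using s1(1) unfolding e_def blinfun.scaleR_right inv
    by (metis (no_types, lifting) divide_self_if one_neq_zero scaleR_one scaleR_scaleR times_divide_eq_left mult_1)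
  have Au: "blinfun_apply A u + b = blinfun_apply E x + c"
    unfolding A u_def using s(1) by (simp add: blinfun.bilinear_simps Ee)
  have nonneg: "0 \<le> blinfun_apply A v \<bullet> v" for v
    using E s(1) unfolding A positive_definite_def by (cases "v = 0") (auto intro: less_imp_le)
  have sym: "blinfun_apply E x \<bullet> e = x \<bullet> blinfun_apply E e"
    using E unfolding positive_definite_def self_adjoint_def by blast
  have Auu: "\<tau> * (blinfun_apply A u \<bullet> u) = s * (blinfun_apply E (x + e) \<bullet> (x + e))"
    unfolding A u_def s(2) blinfun.scaleR_right using s(1) by (simp add: power2_eq_square)
  have ce: "(c - b) \<bullet> e = ((c - w) \<bullet> inv (blinfun_apply E) (c - w)) / (1 + s)\<^sup>2"
    unfolding Ee[symmetric] unfolding e_def blinfun.scaleR_right inv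
    by (simp add: power2_eq_square)
  have "\<gamma> = (\<beta> * (1 + s)\<^sup>2 + 1 / 2 * s * ((c - b) \<bullet> e * (1 + s)\<^sup>2)) / ((1 + s)\<^sup>2 * (s\<^sup>2 + 1))"
    using coeff s1 unfolding star_coefficients_def s_def[symmetric] ce
    by (simp add: s(2)[symmetric])
  also have "\<dots> = ((1 + s)\<^sup>2 * (\<beta> + 1 / 2 * s * ((c - b) \<bullet> e))) / ((1 + s)\<^sup>2 * (s\<^sup>2 + 1))"
    by (simp add: distrib_left mult_ac)
  also have "\<dots> = (\<beta> + 1 / 2 * s * ((c - b) \<bullet> e)) / (s\<^sup>2 + 1)"
    using s1(1) by (intro nonzero_mult_divide_mult_cancel_left) simp
  \<comment> \<open>The quotient defining \<gamma> is thus exactly the balance of the constant terms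
    in the equation; the next fact is the balance of the linear terms.\<close>
  finally have \<gamma>: "\<gamma> * (s\<^sup>2 + 1) = \<beta> + 1 / 2 * s * ((c - b) \<bullet> e)"
    using s1 by (simp add: add.commute)
  have lin: "s * ((c - b) \<bullet> x) + w \<bullet> x = b \<bullet> x"
    using arg_cong[OF b, of "\<lambda>v. v \<bullet> x"] by (simp add: inner_simps algebra_simps)
  have "blinfun_apply E (x + e) \<bullet> (x + e)
      = blinfun_apply E x \<bullet> x + 2 * ((c - b) \<bullet> x) + (c - b) \<bullet> e"
    using sym unfolding blinfun.add_right inner_add_left inner_add_right Ee
    by (simp add: inner_commute)
  then have "f x = s * (blinfun_apply E (x + e) \<bullet> (x + e)) / 2 - \<tau> * \<gamma> + w \<bullet> x + \<beta>"
    using quad \<gamma> lin unfolding quadratic_with_def A s(2)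
    by (simp add: field_simps)
  then have "f x = \<tau> * (1 / 2 * (blinfun_apply A u \<bullet> u) - \<gamma>) + w \<bullet> x + \<beta>"
    using Auu by (simp add: algebra_simps)
  then show "ereal (f x) = ereal \<tau> * legendre (\<lambda>x. ereal (f x)) (blinfun_apply E x + c)
      + ereal (w \<bullet> x) + ereal \<beta>"
    unfolding Au[symmetric] legendre_quadratic_with[OF quad nonneg] by simp
qed

lemma star_quadratic_exists:
  fixes E :: "'a::real_inner \<Rightarrow>\<^sub>L 'a"
  assumes "(UNIV :: 'a set) \<noteq> {0}" "positive_definite E" "\<tau> > 0"
  obtains A b \<gamma> f where "quadratic_with A b \<gamma> f" "star_coefficients \<tau> E c w \<beta> A b \<gamma>"
proof -
  obtain v :: 'a where v: "v \<noteq> 0" using assms(1) by auto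
  then have "sqrt \<tau> *\<^sub>R E \<noteq> 0"
    using assms(2,3) unfolding positive_definite_def by auto
  moreover have "self_adjoint (sqrt \<tau> *\<^sub>R E)"
    using assms(2) unfolding positive_definite_def self_adjoint_def by (simp add: blinfun.scaleR_left)
  ultimately have "quadratic_with (sqrt \<tau> *\<^sub>R E) b \<gamma>
      (\<lambda>x. 1 / 2 * (blinfun_apply (sqrt \<tau> *\<^sub>R E) x \<bullet> x) + b \<bullet> x + \<gamma>)" for b \<gamma>
    unfolding quadratic_with_def by blast
  then show ?thesis
    by (rule that) (simp add: star_coefficients_def)
qed

text \<open>The Fenchel--Young inequality at the pair \<open>(x, E x + c)\<close> bounds every solution from
  below by the quadratic one; conjugation reverses this inequality and (\<open>\<star>\<close>) then bounds it
  from above.\<close>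

lemma solves_star_unique_self_conjugate:
  fixes E :: "'a::real_inner \<Rightarrow>\<^sub>L 'a"
  assumes sol: "solves_star 1 E c c \<beta> g"
    and q_sol: "solves_star 1 E c c \<beta> (\<lambda>x. ereal (q x))"
    and quad: "quadratic_with A b \<gamma> q" and coeff: "star_coefficients 1 E c c \<beta> A b \<gamma>"
  shows "g = (\<lambda>x. ereal (q x))"
proof -
  have "b = (1 / 2 + 1 / 2) *\<^sub>R c"
    using coeff unfolding star_coefficients_def scaleR_left_distrib
    by (simp add: scaleR_2[symmetric] del: scaleR_half_double)
  then have "A = E" "b = c" "\<gamma> = \<beta> / 2"
    using coeff unfolding star_coefficients_def by simp_all
  then have q: "q x = 1 / 2 * (blinfun_apply E x \<bullet> x) + c \<bullet> x + \<beta> / 2" for x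
    using quad unfolding quadratic_with_def by simp
  have lower: "ereal (q x) \<le> g x" for x
  proof (cases "g x")
    case (real r)
    then obtain l where l: "legendre g (blinfun_apply E x + c) = ereal l" "r = l + c \<bullet> x + \<beta>"
      using solves_starD[OF sol, of x] by (cases "legendre g (blinfun_apply E x + c)") auto
    have "(blinfun_apply E x + c) \<bullet> x - r \<le> l"
      using fenchel_young[of "blinfun_apply E x + c" x g] real l by simp
    then show ?thesis unfolding q real using l(2) by (simp add: inner_simps)
  next
    case MInf
    then show ?thesis using solves_star_proper[OF sol] proper_funD by fastforce
  qed simp
  show ?thesis
  proof
    fix x
    have "g x \<le> ereal (q x)"
      unfolding solves_starD[OF sol, of x] solves_starD[OF q_sol, of x]
      by (intro add_mono ereal_mult_left_mono legendre_antimono lower) auto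
    with lower[of x] show "g x = ereal (q x)" by (rule antisym[rotated])
  qed
qed

section \<open>Gradients of real-valued solutions\<close>

text \<open>Along the segment from \<open>x\<close> to \<open>y\<close>, subtract the increment of
  the chord. Convexity keeps the resulting function \<phi> below its value at 0, whereas a failure
  of the inequality would give it a positive derivative there.\<close>

lemma convex_fun_gradient_inequality:
  fixes f :: "'a::real_inner \<Rightarrow> real"
  assumes conv: "convex_fun (\<lambda>x. ereal (f x))" and grad: "GDERIV f x :> g"
  shows "f x + g \<bullet> (y - x) \<le> f y"
proof (rule ccontr)
  assume "\<not> ?thesis"
  then have pos: "0 < (y - x) \<bullet> g - (f y - f x)"
    by (simp add: inner_commute)
  define \<phi> where "\<phi> t = f (x + t *\<^sub>R (y - x)) - t * (f y - f x)" for t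
  have "((\<lambda>t. x + t *\<^sub>R (y - x)) has_derivative (\<lambda>h. h *\<^sub>R (y - x))) (at 0)"
    by (auto intro!: derivative_eq_intros)
  moreover have "(f has_derivative (\<lambda>h. h \<bullet> g)) (at (x + 0 *\<^sub>R (y - x)))"
    using grad unfolding gderiv_def by simp
  ultimately have "((\<lambda>t. f (x + t *\<^sub>R (y - x))) has_derivative (\<lambda>h. (h *\<^sub>R (y - x)) \<bullet> g)) (at 0)"
    by (rule has_derivative_compose)
  then have "((\<lambda>t. f (x + t *\<^sub>R (y - x))) has_real_derivative (y - x) \<bullet> g) (at 0)"
    by (rule has_derivative_imp_has_field_derivative) (simp add: mult.commute)
  then have "(\<phi> has_real_derivative (y - x) \<bullet> g - (f y - f x)) (at 0)"
    unfolding \<phi>_def by (auto intro!: derivative_eq_intros)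
  then obtain d where d: "d > 0" "\<And>h. 0 < h \<Longrightarrow> h < d \<Longrightarrow> \<phi> 0 < \<phi> (0 + h)"
    using DERIV_pos_inc_right pos by blast
  define h where "h = min (d / 2) (1 / 2)"
  have h: "0 < h" "h < d" "h < 1" using d(1) by (auto simp: h_def)
  have "f ((1 - h) *\<^sub>R x + h *\<^sub>R y) \<le> (1 - h) * f x + h * f y"
    using conv h unfolding convex_fun_def by force
  moreover have "(1 - h) *\<^sub>R x + h *\<^sub>R y = x + h *\<^sub>R (y - x)"
    by (simp add: algebra_simps)
  ultimately have "\<phi> h \<le> \<phi> 0"
    unfolding \<phi>_def by (simp add: algebra_simps)
  with d(2)[OF h(1,2)] show False by simp
qed

text \<open>A real value of \<open>f\<close> excludes an infinite conjugate, so the equation can be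
  solved for the conjugate.\<close>

lemma legendre_real_solution:
  assumes sol: "solves_star \<tau> E c w \<beta> (\<lambda>x. ereal (f x))" and tau: "\<tau> > 0"
  shows "legendre (\<lambda>x. ereal (f x)) (blinfun_apply E x + c) = ereal ((f x - w \<bullet> x - \<beta>) / \<tau>)"
proof (cases "legendre (\<lambda>x. ereal (f x)) (blinfun_apply E x + c)")
  case (real l)
  then have "f x - w \<bullet> x - \<beta> = \<tau> * l"
    using solves_starD[OF sol, of x] by simp
  then show ?thesis using real tau by simp
qed (use solves_starD[OF sol, of x] tau in auto)

text \<open>The gradient inequality says that \<open>x\<close> attains the supremum.\<close>

lemma legendre_gradient:
  assumes conv: "convex_fun (\<lambda>x. ereal (f x))" and grad: "GDERIV f x :> g"
  shows "legendre (\<lambda>x. ereal (f x)) g = ereal (g \<bullet> x - f x)"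
proof -
  have "g \<bullet> y - f y \<le> g \<bullet> x - f x" for y
    using convex_fun_gradient_inequality[OF assms, of y] by (simp add: inner_diff_right)
  then show ?thesis
    unfolding legendre_def by (intro antisym SUP_least SUP_upper2[of x]) auto
qed

text \<open>The conjugate at \<open>E z + c\<close> is computed twice, once from the equation at
  \<open>z\<close> and once from the gradient at \<open>x\<close>.\<close>

lemma star_young_equality:
  assumes sol: "solves_star \<tau> E c w \<beta> (\<lambda>x. ereal (f x))" and tau: "\<tau> > 0"
    and grad: "GDERIV f x :> blinfun_apply E z + c"
  shows "f x + (f z - w \<bullet> z - \<beta>) / \<tau> = (blinfun_apply E z + c) \<bullet> x"
  using legendre_gradient[OF solves_star_convex[OF sol tau] grad]
  unfolding legendre_real_solution[OF sol tau] by simp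

text \<open>The conjugate \<open>f\<^sup>*\<close> is differentiable by (\<open>\<star>\<close>), and by the Fenchel--Young equality
  its gradient inverts that of \<open>f\<close>.\<close>

lemma star_gradient:
  fixes E :: "'a::real_inner \<Rightarrow>\<^sub>L 'a"
  assumes sol: "solves_star \<tau> E c w \<beta> (\<lambda>x. ereal (f x))" and tau: "\<tau> > 0"
    and E: "self_adjoint E"
    and gx: "GDERIV f x :> blinfun_apply E z + c" and gz: "GDERIV f z :> g"
  shows "g = \<tau> *\<^sub>R blinfun_apply E x + w"
proof -
  \<comment> \<open>Up to the constant \<open>f x\<close>, this is the gap in the Fenchel--Young
    inequality at the pair \<open>(x, E y + c)\<close>. The gap is nonnegative and vanishes at
    \<open>y = z\<close>, so the derivative at \<open>z\<close> is zero.\<close>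
  define \<psi> where "\<psi> y = (f y - w \<bullet> y - \<beta>) / \<tau> - (blinfun_apply E y + c) \<bullet> x" for y
  have min: "\<psi> z \<le> \<psi> y" for y
  proof -
    have "(blinfun_apply E y + c) \<bullet> x - f x \<le> (f y - w \<bullet> y - \<beta>) / \<tau>"
      using fenchel_young[of "blinfun_apply E y + c" x "\<lambda>x. ereal (f x)"]
      unfolding legendre_real_solution[OF sol tau] by simp
    then show ?thesis
      using star_young_equality[OF sol tau gx] unfolding \<psi>_def by simp
  qed
  have "(\<psi> has_derivative (\<lambda>h. (h \<bullet> g - w \<bullet> h) / \<tau> - blinfun_apply E h \<bullet> x)) (at z)"
    using gz tau unfolding \<psi>_def gderiv_def by (auto intro!: derivative_eq_intros)
  then have "(\<lambda>h. (h \<bullet> g - w \<bullet> h) / \<tau> - blinfun_apply E h \<bullet> x) = (\<lambda>h. 0)"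
    by (rule differential_zero_maxmin[OF UNIV_I open_UNIV]) (use min in blast)
  then have zero: "(h \<bullet> g - w \<bullet> h) / \<tau> - blinfun_apply E h \<bullet> x = 0" for h
    by metis
  have "h \<bullet> g = h \<bullet> (\<tau> *\<^sub>R blinfun_apply E x + w)" for h
  proof -
    have "blinfun_apply E h \<bullet> x = h \<bullet> blinfun_apply E x"
      using E unfolding self_adjoint_def by blast
    then show ?thesis
      using zero[of h] tau by (simp add: inner_add_right inner_commute field_simps)
  qed
  then show ?thesis
    by (metis vector_eq_ldot inner_commute)
qed

section \<open>Solutions with affine gradient\<close>

text \<open>The gradient relation amounts to \<open>A\<close> composed with the inverse of
  \<open>E\<close> and again \<open>A\<close> being \<tau> \<open>E\<close>. Monotonicity of the
  gradient and positive definiteness of \<open>E\<close> single out the root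
  \<open>sqrt \<tau> *\<^sub>R E\<close>.\<close>

lemma star_affine_gradient_coefficients:
  fixes E A :: "'a::real_inner \<Rightarrow>\<^sub>L 'a"
  assumes sol: "solves_star \<tau> E c w \<beta> (\<lambda>x. ereal (f x))" and tau: "\<tau> > 0"
    and E: "positive_definite E" and bij: "bij (blinfun_apply E)"
    and grad: "\<And>x. GDERIV f x :> blinfun_apply A x + b"
  shows "A = sqrt \<tau> *\<^sub>R E" and "b = (1 / (1 + sqrt \<tau>)) *\<^sub>R (w + sqrt \<tau> *\<^sub>R c)"
proof -
  define s where "s = sqrt \<tau>"
  have s: "s > 0" "\<tau> = s * s" using tau by (auto simp: s_def)
  define z where "z x = inv (blinfun_apply E) (blinfun_apply A x + b - c)" for x
  have Ez: "blinfun_apply E (z x) + c = blinfun_apply A x + b" for x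
    using bij unfolding z_def by (simp add: bij_is_surj surj_f_inv_f)
  have Az: "blinfun_apply A (z x) + b = \<tau> *\<^sub>R blinfun_apply E x + w" for x
    by (rule star_gradient[OF sol tau _ _ grad])
      (use E grad[of x] in \<open>simp_all add: positive_definite_def Ez\<close>)
  \<comment> \<open>Adding the gradient inequalities from 0 to \<open>v\<close> and from
    \<open>v\<close> to 0 makes the values of \<open>f\<close> cancel.\<close>
  have nonneg: "0 \<le> blinfun_apply A v \<bullet> v" for v
    using convex_fun_gradient_inequality[OF solves_star_convex[OF sol tau] grad, of 0 v]
      convex_fun_gradient_inequality[OF solves_star_convex[OF sol tau] grad, of v 0]
    by (simp add: inner_add_left)
  have A: "blinfun_apply A x = s *\<^sub>R blinfun_apply E x" for x
  proof -
    \<comment> \<open>This measures how far the linear part of \<open>z\<close> is from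
      multiplication by \<open>s\<close>. It satisfies \<open>A v = - s E v\<close>; pairing with
      \<open>v\<close> gives opposite signs unless \<open>v = 0\<close>.\<close>
    define v where "v = z x - z 0 - s *\<^sub>R x"
    have "blinfun_apply E (z x) - blinfun_apply E (z 0) = blinfun_apply A x"
      using arg_cong2[OF Ez[of x] Ez[of 0], of "(-)"] by simp
    then have Ev: "blinfun_apply E v = blinfun_apply A x - s *\<^sub>R blinfun_apply E x"
      unfolding v_def by (simp add: blinfun.bilinear_simps)
    have "blinfun_apply A (z x) - blinfun_apply A (z 0) = \<tau> *\<^sub>R blinfun_apply E x"
      using arg_cong2[OF Az[of x] Az[of 0], of "(-)"] by simp
    then have "blinfun_apply A v = - (s *\<^sub>R blinfun_apply E v)"
      unfolding Ev unfolding v_def s(2) by (simp add: blinfun.bilinear_simps scaleR_diff_right)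
    then have "s * (blinfun_apply E v \<bullet> v) \<le> 0"
      using nonneg[of v] by simp
    then have "v = 0"
      using E s(1) unfolding positive_definite_def by (metis mult_pos_pos not_less)
    then show ?thesis using Ev by simp
  qed
  then show "A = sqrt \<tau> *\<^sub>R E"
    by (intro blinfun_eqI) (simp add: blinfun.scaleR_left s_def)
  have "blinfun_apply E (z 0) = b - c"
    using Ez[of 0] by (simp add: eq_diff_eq)
  then have "w = s *\<^sub>R (b - c) + b"
    using Az[of 0] unfolding A by simp
  then have "w + s *\<^sub>R c = (1 + s) *\<^sub>R b"
    by (simp add: algebra_simps)
  moreover have "1 + s \<noteq> 0" using s(1) by simp
  ultimately show "b = (1 / (1 + sqrt \<tau>)) *\<^sub>R (w + sqrt \<tau> *\<^sub>R c)"
    unfolding s_def[symmetric] by simp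
qed

text \<open>The coefficients of the gradient are forced, so \<open>f\<close> and \<open>q\<close>
  differ by a constant \<open>k\<close>. Subtracting their Fenchel--Young equalities at a common
  pair gives \<open>k * (1 + 1 / \<tau>) = 0\<close>.\<close>

lemma star_unique_affine_gradient:
  fixes E A :: "'a::real_inner \<Rightarrow>\<^sub>L 'a"
  assumes sol: "solves_star \<tau> E c w \<beta> (\<lambda>x. ereal (f x))" and tau: "\<tau> > 0"
    and E: "positive_definite E" and bij: "bij (blinfun_apply E)"
    and grad: "\<And>x. GDERIV f x :> blinfun_apply A x + b"
    and quad: "quadratic_with A0 b0 \<gamma>0 q" and coeff: "star_coefficients \<tau> E c w \<beta> A0 b0 \<gamma>0"
  shows "f = q"
proof -
  have q_sol: "solves_star \<tau> E c w \<beta> (\<lambda>x. ereal (q x))"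
    by (rule star_coefficients_solves_star[OF E bij tau quad coeff])
  have "A = A0" "b = b0"
    using star_affine_gradient_coefficients[OF sol tau E bij grad] coeff
    unfolding star_coefficients_def by simp_all
  then have q_grad: "GDERIV q x :> blinfun_apply A x + b" for x
    using GDERIV_quadratic_with[OF quad] by simp
  have "((\<lambda>x. f x - q x) has_derivative (\<lambda>h. 0)) (at x)" for x
    using GDERIV_diff[OF grad q_grad] unfolding gderiv_def by simp
  then have "f x - q x = f 0 - q 0" for x
    by (intro has_derivative_zero_unique[of UNIV]) auto
  moreover define k where "k = f 0 - q 0"
  ultimately have k: "f x = q x + k" for x by (metis add.commute diff_add_cancel)
  \<comment> \<open>The choice \<open>E z + c = b\<close> matches the gradient at 0, and pairing
    with 0 makes the right-hand side of the equality vanish.\<close>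
  obtain z where z: "blinfun_apply E z = b - c"
    using bij by (metis bij_is_surj surjD)
  have "q 0 + (q z - w \<bullet> z - \<beta>) / \<tau> = 0"
    using star_young_equality[OF q_sol tau, of 0 z] q_grad[of 0] z by simp
  moreover have "f 0 + (f z - w \<bullet> z - \<beta>) / \<tau> = 0"
    using star_young_equality[OF sol tau, of 0 z] grad[of 0] z by simp
  ultimately have "k * (1 + 1 / \<tau>) = 0"
    unfolding k by (simp add: add_divide_distrib diff_divide_distrib algebra_simps)
  then have "k = 0" using tau by (simp add: add_nonneg_eq_0_iff)
  then show ?thesis using k by auto
qed

section \<open>Invariance under a homothety\<close>

text \<open>The gradient relation is applied twice, along \<open>x\<close>, \<open>z\<close>,
  \<open>z'\<close> with \<open>E z + c = G x\<close> and \<open>E z' + c = G z\<close>. The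
  composite map from \<open>x\<close> to \<open>z'\<close> is the homothety of ratio \<tau> whose
  fixed point is \<open>x0\<close>.\<close>

lemma star_gradient_scaling:
  fixes E :: "'a::real_inner \<Rightarrow>\<^sub>L 'a"
  assumes sol: "solves_star \<tau> E c w \<beta> (\<lambda>x. ereal (f x))" and tau: "\<tau> > 0"
    and E: "self_adjoint E" and bij: "bij (blinfun_apply E)"
    and grad: "\<And>x. GDERIV f x :> G x"
    and x0: "(1 - \<tau>) *\<^sub>R blinfun_apply E x0 = w - c"
  shows "G (x0 + \<tau> *\<^sub>R (x - x0)) = \<tau> *\<^sub>R (G x - c) + w"
proof -
  have surj: "\<exists>z. blinfun_apply E z + c = y" for y
    using bij by (metis bij_is_surj surjD diff_add_cancel)
  obtain z where z: "blinfun_apply E z + c = G x" using surj by blast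
  obtain z' where z': "blinfun_apply E z' + c = G z" using surj by blast
  have "G z = \<tau> *\<^sub>R blinfun_apply E x + w"
    using star_gradient[OF sol tau E _ grad] grad z by metis
  then have "blinfun_apply E z' = \<tau> *\<^sub>R blinfun_apply E x + (1 - \<tau>) *\<^sub>R blinfun_apply E x0"
    using z' unfolding x0 by (simp add: algebra_simps)
  also have "\<dots> = blinfun_apply E (x0 + \<tau> *\<^sub>R (x - x0))"
    by (simp add: blinfun.bilinear_simps algebra_simps)
  finally have "z' = x0 + \<tau> *\<^sub>R (x - x0)"
    using bij by (meson bij_is_inj injD)
  moreover have "G z' = \<tau> *\<^sub>R blinfun_apply E z + w"
    using star_gradient[OF sol tau E _ grad] grad z' by metis
  ultimately show ?thesis using z by (metis add_diff_cancel_right')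
qed

lemma star_gradient_affine:
  fixes E :: "'a::real_inner \<Rightarrow>\<^sub>L 'a" and D :: "'a \<Rightarrow> 'a \<Rightarrow>\<^sub>L 'a"
  assumes sol: "solves_star \<tau> E c w \<beta> (\<lambda>x. ereal (f x))" and tau: "\<tau> > 0" "\<tau> \<noteq> 1"
    and E: "self_adjoint E" and bij: "bij (blinfun_apply E)"
    and grad: "\<And>x. GDERIV f x :> G x"
    and deriv: "\<And>x. (G has_derivative blinfun_apply (D x)) (at x)"
    and cont: "isCont D x0"
    and x0: "(1 - \<tau>) *\<^sub>R blinfun_apply E x0 = w - c"
  shows "G x = blinfun_apply (D x0) x + G 0"
proof -
  \<comment> \<open>Differentiating the scaling identity by the chain rule produces a factor \<tau>
    on both sides, which cancels.\<close>
  have homothety: "D (x0 + \<tau> *\<^sub>R v) = D (x0 + v)" for v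
  proof -
    have "((\<lambda>x. x0 + \<tau> *\<^sub>R (x - x0)) has_derivative (\<lambda>h. \<tau> *\<^sub>R h)) (at (x0 + v))"
      by (auto intro!: derivative_eq_intros)
    moreover have "(G has_derivative blinfun_apply (D (x0 + \<tau> *\<^sub>R v))) (at (x0 + \<tau> *\<^sub>R ((x0 + v) - x0)))"
      using deriv by simp
    ultimately have "((\<lambda>x. G (x0 + \<tau> *\<^sub>R (x - x0))) has_derivative
        (\<lambda>h. blinfun_apply (D (x0 + \<tau> *\<^sub>R v)) (\<tau> *\<^sub>R h))) (at (x0 + v))"
      by (rule has_derivative_compose)
    moreover have "((\<lambda>x. G (x0 + \<tau> *\<^sub>R (x - x0))) has_derivative
        (\<lambda>h. \<tau> *\<^sub>R blinfun_apply (D (x0 + v)) h)) (at (x0 + v))"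
      unfolding star_gradient_scaling[OF sol tau(1) E bij grad x0]
      by (auto intro!: derivative_eq_intros deriv)
    ultimately have eq: "(\<lambda>h. blinfun_apply (D (x0 + \<tau> *\<^sub>R v)) (\<tau> *\<^sub>R h))
        = (\<lambda>h. \<tau> *\<^sub>R blinfun_apply (D (x0 + v)) h)"
      by (rule has_derivative_unique)
    show ?thesis
    proof (rule blinfun_eqI)
      fix h
      show "blinfun_apply (D (x0 + \<tau> *\<^sub>R v)) h = blinfun_apply (D (x0 + v)) h"
        using fun_cong[OF eq, of h] tau(1) by (simp add: blinfun.scaleR_right)
    qed
  qed
  \<comment> \<open>Either the homothety or its inverse is a contraction; its iterates carry every
    point to \<open>x0\<close>, where \<open>D\<close> is continuous.\<close>
  define r where "r = (if \<tau> < 1 then \<tau> else 1 / \<tau>)"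
  have r: "\<bar>r\<bar> < 1" using tau by (auto simp: r_def)
  have step: "D (x0 + r *\<^sub>R v) = D (x0 + v)" for v
    using homothety[of v] homothety[of "(1 / \<tau>) *\<^sub>R v"] tau(1) by (auto simp: r_def)
  have "D (x0 + r ^ n *\<^sub>R v) = D (x0 + v)" for n v
  proof (induction n)
    case (Suc n)
    then show ?case using step[of "r ^ n *\<^sub>R v"] by simp
  qed simp
  moreover have "(\<lambda>n. D (x0 + r ^ n *\<^sub>R v)) \<longlonglongrightarrow> D x0" for v
  proof (rule isCont_tendsto_compose[OF cont])
    have "(\<lambda>n. r ^ n) \<longlonglongrightarrow> 0"
      using r LIMSEQ_power_zero[of r] unfolding real_norm_def by blast
    then have "(\<lambda>n. x0 + r ^ n *\<^sub>R v) \<longlonglongrightarrow> x0 + 0 *\<^sub>R v"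
      by (intro tendsto_add tendsto_scaleR tendsto_const)
    then show "(\<lambda>n. x0 + r ^ n *\<^sub>R v) \<longlonglongrightarrow> x0" by simp
  qed
  ultimately have "D (x0 + v) = D x0" for v
    by (simp add: LIMSEQ_const_iff)
  then have D: "D y = D x0" for y by (metis add_diff_cancel_left' add.commute diff_add_cancel)
  have "((\<lambda>x. G x - blinfun_apply (D x0) x) has_derivative (\<lambda>h. 0)) (at y)" for y
    using deriv[of y] unfolding D[of y] by (auto intro!: derivative_eq_intros)
  then have "G x - blinfun_apply (D x0) x = G 0 - blinfun_apply (D x0) 0"
    by (intro has_derivative_zero_unique[of UNIV]) auto
  then show ?thesis by (simp add: algebra_simps)
qed

section \<open>Examples on the real line\<close>

lemma blinfun_neg_id:
  "bij (blinfun_apply (- id_blinfun :: real \<Rightarrow>\<^sub>L real))"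
  "\<not> positive_definite (- id_blinfun :: real \<Rightarrow>\<^sub>L real)"
proof -
  show "bij (blinfun_apply (- id_blinfun :: real \<Rightarrow>\<^sub>L real))"
    by (rule bij_betw_byWitness[where f' = uminus]) (auto simp: blinfun.minus_left)
  show "\<not> positive_definite (- id_blinfun :: real \<Rightarrow>\<^sub>L real)"
    unfolding positive_definite_def by (auto simp: blinfun.minus_left intro!: exI[of _ 1])
qed

text \<open>Applying the equation twice gives \<open>f (x + 1) \<le> f x - x\<close>, so \<open>f\<close> decreases quadratically
  along \<open>x + n\<close>, whereas it has an affine minorant.\<close>

lemma no_solution_neg_id:
  "\<not> solves_star 1 (- id_blinfun :: real \<Rightarrow>\<^sub>L real) 1 0 0 f"
proof
  assume sol: "solves_star 1 (- id_blinfun :: real \<Rightarrow>\<^sub>L real) 1 0 0 f"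
  have f: "f x = legendre f (1 - x)" for x
    using solves_starD[OF sol, of x]
    by (simp add: blinfun.minus_left add.commute[of _ 1] zero_ereal_def[symmetric])
  have pr: "proper_fun f" using solves_star_proper[OF sol] by simp
  then obtain x0 r where r: "f x0 = ereal r"
    unfolding proper_fun_def by (metis ereal_cases less_irrefl)
  have young: "ereal ((1 - x) * y) - f y \<le> f x" for x y
    using fenchel_young[of "1 - x" y f] f[of x] by simp
  \<comment> \<open>The equation at \<open>x + 1\<close> reads
    \<open>f (x + 1) = legendre f (- x)\<close>. Each term of this supremum is bounded by
    rearranging \<open>young\<close> with the roles of the two points exchanged.\<close>
  have step: "f (x + 1) \<le> ereal (q - x)" if q: "f x \<le> ereal q" for x q
  proof -
    have "legendre f (- x) \<le> ereal (q - x)"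
      unfolding legendre_def
    proof (rule SUP_least)
      fix u
      have *: "ereal ((1 - u) * x) - f x \<le> f u" by (rule young)
      obtain p where p: "f x = ereal p" "p \<le> q"
        using q proper_funD[OF pr, of x] by (cases "f x") auto
      show "ereal (- x \<bullet> u) - f u \<le> ereal (q - x)"
        using * p by (cases "f u") (auto simp: algebra_simps)
    qed
    then show ?thesis using f[of "x + 1"] by simp
  qed
  \<comment> \<open>Iterating \<open>step\<close> subtracts \<open>x0 + i\<close> for each
    \<open>i < n\<close>.\<close>
  have upper: "f (x0 + real n) \<le> ereal (r - n * x0 - n * (real n - 1) / 2)" for n
  proof (induction n)
    case (Suc n)
    have "r - n * x0 - n * (real n - 1) / 2 - (x0 + n)
        = r - Suc n * x0 - Suc n * (real (Suc n) - 1) / 2"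
      by (simp add: field_simps)
    with step[OF Suc] show ?case by (simp add: add_ac)
  qed (simp add: r)
  \<comment> \<open>The affine minorant from \<open>young\<close> at \<open>x0\<close> is compared
    with \<open>upper\<close>; the terms in \<open>n * x0\<close> cancel.\<close>
  have bound: "n + n * (real n - 1) / 2 \<le> 2 * r - (1 - x0) * x0" for n
  proof -
    have "ereal ((1 - x0) * (x0 + n)) - f (x0 + n) \<le> ereal r"
      using young[of x0 "x0 + n"] young[of "x0 + n" x0] r
        by (cases "f (x0 + n)") (auto simp: algebra_simps)
    then have "(1 - x0) * (x0 + n) - r \<le> r - n * x0 - n * (real n - 1) / 2"
      using upper[of n] proper_funD[OF pr, of "x0 + n"] by (cases "f (x0 + n)") auto
    then show ?thesis by (simp add: algebra_simps)
  qed
  obtain n :: nat where n: "2 * r - (1 - x0) * x0 < n" "n \<ge> 1"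
    using reals_Archimedean2[of "max 1 (2 * r - (1 - x0) * x0)"]
    by (metis less_imp_le max_less_iff_conj of_nat_1 of_nat_le_iff)
  then have "0 \<le> n * (real n - 1) / 2" by simp
  with bound[of n] n(1) show False by simp
qed

text \<open>For \<open>a > 0\<close>, conjugation exchanges the coefficients \<open>a\<close> and
  \<open>1 / a\<close> on each half-line, and reflection exchanges the half-lines. Every such
  function is therefore fixed by conjugation followed by reflection.\<close>

definition skew_parabola :: "real \<Rightarrow> real \<Rightarrow> real" where
  "skew_parabola a x = (if 0 \<le> x then a * x\<^sup>2 / 2 else x\<^sup>2 / (2 * a))"

text \<open>If \<open>x\<close> and \<open>u\<close> have the same sign, the left side is at most 0.
  Otherwise one lies on each branch, and the difference of the two sides is the square
  \<open>(a * p + n)\<^sup>2 / (2 * a)\<close>.\<close>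

lemma skew_parabola_young:
  assumes "a > 0"
  shows "- (x * u) \<le> skew_parabola a u + skew_parabola a x"
proof -
  have mixed: "- (p * n) \<le> a * p\<^sup>2 / 2 + n\<^sup>2 / (2 * a)" for p n
  proof -
    have "0 \<le> (a * p + n)\<^sup>2 / (2 * a)" using assms by simp
    also have "\<dots> = a * p\<^sup>2 / 2 + n\<^sup>2 / (2 * a) + p * n"
      using assms by (simp add: field_simps power2_eq_square)
    finally show ?thesis by simp
  qed
  have same: "- (x * u) \<le> skew_parabola a u + skew_parabola a x" if "0 \<le> x * u"
  proof -
    have "0 \<le> skew_parabola a v" for v using assms by (simp add: skew_parabola_def)
    then show ?thesis using that by (smt (verit))
  qed
  show ?thesis
  proof (cases "0 \<le> x * u")
    case False
    then have "0 \<le> x \<and> u < 0 \<or> x < 0 \<and> 0 \<le> u"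
      by (auto simp: not_le mult_less_0_iff)
    then show ?thesis
      using mixed[of x u] mixed[of u x] by (auto simp: skew_parabola_def mult.commute)
  qed (rule same)
qed

lemma skew_parabola_solves_star:
  assumes "a > 0"
  shows "solves_star 1 (- id_blinfun :: real \<Rightarrow>\<^sub>L real) 0 0 0 (\<lambda>x. ereal (skew_parabola a x))"
proof -
  have "legendre (\<lambda>x. ereal (skew_parabola a x)) (- x) = ereal (skew_parabola a x)" for x
  proof -
    \<comment> \<open>The witness is minus the derivative of \<open>skew_parabola a\<close> at
      \<open>x\<close>, where the inequality of the preceding lemma becomes an equality.\<close>
    have "\<exists>u. skew_parabola a x \<le> - (x * u) - skew_parabola a u"
    proof (cases "0 < x")
      case True
      then show ?thesis using assms
        by (intro exI[of _ "- (a * x)"])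
          (auto simp: skew_parabola_def power2_eq_square field_simps mult_le_0_iff zero_le_mult_iff)
    next
      case False
      then show ?thesis using assms
        by (intro exI[of _ "- (x / a)"])
          (auto simp: skew_parabola_def power2_eq_square field_simps)
    qed
    then obtain u where u: "skew_parabola a x \<le> - (x * u) - skew_parabola a u" by blast
    show ?thesis
      unfolding legendre_def
    proof (intro antisym SUP_least SUP_upper2[of u])
      fix v
      show "ereal (- x \<bullet> v) - ereal (skew_parabola a v) \<le> ereal (skew_parabola a x)"
        using skew_parabola_young[OF assms, of x v] by simp
    qed (use u in auto)
  qed
  then show ?thesis
    unfolding solves_star_def by (simp add: blinfun.minus_left)
qed

lemma inj_skew_parabola: "inj skew_parabola"
proof (rule injI)
  fix a b assume "skew_parabola a = skew_parabola b"
  then have "skew_parabola a 1 = skew_parabola b 1" by simp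
  then show "a = b" by (simp add: skew_parabola_def)
qed

lemma skew_parabola_not_quadratic: "\<not> quadratic (skew_parabola 2)"
proof
  assume "quadratic (skew_parabola 2)"
  then obtain A b \<gamma> where q: "\<And>x. skew_parabola 2 x = 1 / 2 * (blinfun_apply A x \<bullet> x) + b \<bullet> x + \<gamma>"
    unfolding quadratic_def quadratic_with_def by blast
  have A: "blinfun_apply A x = x * blinfun_apply A 1" for x
    using blinfun.scaleR_right[of A x 1] by simp
  have "skew_parabola 2 x = 1 / 2 * (blinfun_apply A 1 * x\<^sup>2) + b * x + \<gamma>" for x
    unfolding q[of x] inner_real_def by (subst A) (simp add: power2_eq_square)
  \<comment> \<open>The values at 0, 1 and 2 force the polynomial to be the square of
    \<open>x\<close>, but the value at -1 is 1/4.\<close>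
  from this[of 0] this[of 1] this[of 2] this[of "- 1"] show False
    by (simp add: skew_parabola_def)
qed

section \<open>Assembly of the four statements\<close>

lemma star_quadratic_properties:
  fixes E :: "'a::real_inner \<Rightarrow>\<^sub>L 'a"
  assumes E: "positive_definite E" and bij: "bij (blinfun_apply E)" and tau: "\<tau> > 0"
    and quad: "quadratic_with A b \<gamma> q" and coeff: "star_coefficients \<tau> E c w \<beta> A b \<gamma>"
  shows "strictly_convex_fun q" and "bij (blinfun_apply A)"
    and "twice_differentiable_cont_at x q"
proof -
  have A: "blinfun_apply A v = sqrt \<tau> *\<^sub>R blinfun_apply E v" for v
    using coeff unfolding star_coefficients_def by (simp add: blinfun.scaleR_left)
  show "strictly_convex_fun q"
    by (rule strictly_convex_quadratic_with[OF quad])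
      (use E tau in \<open>simp add: A positive_definite_def\<close>)
  have "bij (\<lambda>v. sqrt \<tau> *\<^sub>R v :: 'a)"
    using tau by (intro bij_betw_byWitness[where f' = "\<lambda>v. (1 / sqrt \<tau>) *\<^sub>R v"]) auto
  then have "bij ((\<lambda>v. sqrt \<tau> *\<^sub>R v) \<circ> blinfun_apply E)"
    using bij by (rule bij_comp[rotated])
  moreover have "(\<lambda>v. sqrt \<tau> *\<^sub>R v) \<circ> blinfun_apply E = blinfun_apply A"
    by (auto simp: A)
  ultimately show "bij (blinfun_apply A)" by simp
  have "((\<lambda>x. blinfun_apply A x + b) has_derivative blinfun_apply A) (at y)" for y
    by (auto intro!: derivative_eq_intros)
  then show "twice_differentiable_cont_at x q"
    unfolding twice_differentiable_cont_at_def
    by (intro exI[of _ "\<lambda>x. blinfun_apply A x + b"] exI[of _ "\<lambda>x. A"] conjI allI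
        GDERIV_quadratic_with[OF quad]) auto
qed

lemma star_unique_twice_differentiable:
  fixes E :: "'a::real_inner \<Rightarrow>\<^sub>L 'a"
  assumes sol: "solves_star \<tau> E c w \<beta> (\<lambda>x. ereal (f x))" and tau: "\<tau> > 0" "\<tau> \<noteq> 1"
    and E: "positive_definite E" and bij: "bij (blinfun_apply E)"
    and diff: "twice_differentiable_cont_at
      ((1 / (1 - \<tau>)) *\<^sub>R (inv (blinfun_apply E) w - inv (blinfun_apply E) c)) f"
    and quad: "quadratic_with A b \<gamma> q" and coeff: "star_coefficients \<tau> E c w \<beta> A b \<gamma>"
  shows "f = q"
proof -
  define x0 where "x0 = (1 / (1 - \<tau>)) *\<^sub>R (inv (blinfun_apply E) w - inv (blinfun_apply E) c)"
  \<comment> \<open>Applying \<open>E\<close> clears the inverses and yields the equation for the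
    centre of the homothety.\<close>
  have x0: "(1 - \<tau>) *\<^sub>R blinfun_apply E x0 = w - c"
    using tau(2) bij unfolding x0_def
    by (simp add: blinfun.bilinear_simps bij_is_surj surj_f_inv_f)
  obtain G D where GD: "\<And>x. GDERIV f x :> G x"
      "\<And>x. (G has_derivative blinfun_apply (D x)) (at x)" "isCont D x0"
    using diff unfolding twice_differentiable_cont_at_def x0_def[symmetric] by blast
  have "G x = blinfun_apply (D x0) x + G 0" for x
    by (rule star_gradient_affine[OF sol tau _ bij GD x0]) (use E in \<open>simp add: positive_definite_def\<close>)
  then have "GDERIV f x :> blinfun_apply (D x0) x + G 0" for x
    using GD(1) by metis
  then show ?thesis
    by (rule star_unique_affine_gradient[OF sol tau(1) E bij _ quad coeff])
qed

theorem theorem3p1: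
  fixes E :: "'a::{real_inner, complete_space} \<Rightarrow>\<^sub>L 'a"
    and c w :: 'a and \<tau> \<beta> :: real
  assumes nontrivial: "(UNIV :: 'a set) \<noteq> {0}"
    and tau: "\<tau> > 0"
    and invertible: "bij (blinfun_apply E)"
  shows
    "(\<comment> \<open>(a)\<close>
      \<forall>f. solves_star \<tau> E c w \<beta> f \<longrightarrow> proper_fun f \<and> convex_fun f \<and> lsc_fun f)
   \<and> (\<comment> \<open>(b)\<close>
      positive_definite E \<longrightarrow>
      (\<exists>f :: 'a \<Rightarrow> real.
         solves_star \<tau> E c w \<beta> (\<lambda>x. ereal (f x)) \<and>
         strictly_convex_fun f \<and>
         (\<exists>A b \<gamma>. quadratic_with A b \<gamma> f \<and> star_coefficients \<tau> E c w \<beta> A b \<gamma>) \<and>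
         quadratic_invertible f \<and>
         (\<forall>g. solves_star \<tau> E c w \<beta> (\<lambda>x. ereal (g x)) \<and> quadratic_invertible g \<longrightarrow> g = f)))
   \<and> (\<comment> \<open>(c)(i)\<close>
      positive_definite E \<and> \<tau> = 1 \<and> c = w \<longrightarrow>
      (\<exists>!g :: 'a \<Rightarrow> ereal. solves_star \<tau> E c w \<beta> g) \<and>
      (\<forall>g. solves_star \<tau> E c w \<beta> g \<longrightarrow>
         (\<exists>f :: 'a \<Rightarrow> real. g = (\<lambda>x. ereal (f x)) \<and> strictly_convex_fun f \<and>
            (\<exists>A b \<gamma>. quadratic_with A b \<gamma> f \<and> star_coefficients \<tau> E c w \<beta> A b \<gamma>))))
   \<and> (\<comment> \<open>(c)(ii)\<close>
      positive_definite E \<and> (\<exists>B :: 'a set. finite B \<and> span B = UNIV) \<and> \<tau> \<noteq> 1 \<longrightarrow>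
      (let x0 = (1 / (1 - \<tau>)) *\<^sub>R (inv (blinfun_apply E) w - inv (blinfun_apply E) c) in
        (\<exists>!f :: 'a \<Rightarrow> real. twice_differentiable_cont_at x0 f \<and>
           solves_star \<tau> E c w \<beta> (\<lambda>x. ereal (f x))) \<and>
        (\<forall>f :: 'a \<Rightarrow> real. twice_differentiable_cont_at x0 f \<and>
           solves_star \<tau> E c w \<beta> (\<lambda>x. ereal (f x)) \<longrightarrow>
           strictly_convex_fun f \<and>
           (\<exists>A b \<gamma>. quadratic_with A b \<gamma> f \<and> star_coefficients \<tau> E c w \<beta> A b \<gamma>))))
   \<and> (\<comment> \<open>(d), no solution; the space is the real line\<close>
      \<exists>(E' :: real \<Rightarrow>\<^sub>L real) \<tau>' c' w' \<beta>'.
        bij (blinfun_apply E') \<and> \<not> positive_definite E' \<and> \<tau>' > 0 \<and>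
        (\<nexists>f. solves_star \<tau>' E' c' w' \<beta>' f))
   \<and> (\<comment> \<open>(d), at least one solution\<close>
      \<exists>(E' :: real \<Rightarrow>\<^sub>L real) \<tau>' c' w' \<beta>'.
        bij (blinfun_apply E') \<and> \<not> positive_definite E' \<and> \<tau>' > 0 \<and>
        (\<exists>f. solves_star \<tau>' E' c' w' \<beta>' f))
   \<and> (\<comment> \<open>(d), infinitely many solutions, some of them not quadratic\<close>
      \<exists>(E' :: real \<Rightarrow>\<^sub>L real) \<tau>' c' w' \<beta>'.
        bij (blinfun_apply E') \<and> \<not> positive_definite E' \<and> \<tau>' > 0 \<and>
        infinite {f. solves_star \<tau>' E' c' w' \<beta>' f} \<and>
        (\<exists>f. solves_star \<tau>' E' c' w' \<beta>' f \<and>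
             \<not> (\<exists>q. quadratic q \<and> f = (\<lambda>x. ereal (q x)))))"
proof -
  have a: "proper_fun f \<and> convex_fun f \<and> lsc_fun f" if "solves_star \<tau> E c w \<beta> f" for f
    using solves_star_proper solves_star_convex solves_star_lsc tau that by blast
  have b: "\<exists>f :: 'a \<Rightarrow> real.
         solves_star \<tau> E c w \<beta> (\<lambda>x. ereal (f x)) \<and>
         strictly_convex_fun f \<and>
         (\<exists>A b \<gamma>. quadratic_with A b \<gamma> f \<and> star_coefficients \<tau> E c w \<beta> A b \<gamma>) \<and>
         quadratic_invertible f \<and>
         (\<forall>g. solves_star \<tau> E c w \<beta> (\<lambda>x. ereal (g x)) \<and> quadratic_invertible g \<longrightarrow> g = f)"
    if E: "positive_definite E"
  proof -
    obtain A b \<gamma> q where q: "quadratic_with A b \<gamma> q" "star_coefficients \<tau> E c w \<beta> A b \<gamma>"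
      by (rule star_quadratic_exists[OF nontrivial E tau])
    have "g = q" if "solves_star \<tau> E c w \<beta> (\<lambda>x. ereal (g x))" "quadratic_invertible g" for g
      using that star_unique_affine_gradient[OF that(1) tau E invertible _ q]
        GDERIV_quadratic_with unfolding quadratic_invertible_def by blast
    then show ?thesis
      using q star_coefficients_solves_star[OF E invertible tau q]
        star_quadratic_properties(1,2)[OF E invertible tau q]
      unfolding quadratic_invertible_def by (intro exI[of _ q]) blast
  qed
  have ci: "(\<exists>!g :: 'a \<Rightarrow> ereal. solves_star \<tau> E c w \<beta> g) \<and>
      (\<forall>g. solves_star \<tau> E c w \<beta> g \<longrightarrow>
         (\<exists>f :: 'a \<Rightarrow> real. g = (\<lambda>x. ereal (f x)) \<and> strictly_convex_fun f \<and>
            (\<exists>A b \<gamma>. quadratic_with A b \<gamma> f \<and> star_coefficients \<tau> E c w \<beta> A b \<gamma>)))"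
    if hyp: "positive_definite E \<and> \<tau> = 1 \<and> c = w"
  proof -
    have E: "positive_definite E" using hyp by blast
    obtain A b \<gamma> q where q: "quadratic_with A b \<gamma> q" "star_coefficients \<tau> E c w \<beta> A b \<gamma>"
      by (rule star_quadratic_exists[OF nontrivial E tau])
    note q_sol = star_coefficients_solves_star[OF E invertible tau q]
    have uniq: "g = (\<lambda>x. ereal (q x))" if "solves_star \<tau> E c w \<beta> g" for g
      using solves_star_unique_self_conjugate[of E w \<beta> g q A b \<gamma>] that q_sol q hyp by simp
    show ?thesis
    proof (intro conjI allI impI)
      show "\<exists>!g. solves_star \<tau> E c w \<beta> g"
        using q_sol uniq by (rule ex1I)
    next
      fix g assume "solves_star \<tau> E c w \<beta> g"
      then show "\<exists>f. g = (\<lambda>x. ereal (f x)) \<and> strictly_convex_fun f \<and>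
            (\<exists>A b \<gamma>. quadratic_with A b \<gamma> f \<and> star_coefficients \<tau> E c w \<beta> A b \<gamma>)"
        using uniq q star_quadratic_properties(1)[OF E invertible tau q]
        by (intro exI[of _ q]) blast
    qed
  qed
  have cii: "let x0 = (1 / (1 - \<tau>)) *\<^sub>R (inv (blinfun_apply E) w - inv (blinfun_apply E) c) in
        (\<exists>!f :: 'a \<Rightarrow> real. twice_differentiable_cont_at x0 f \<and>
           solves_star \<tau> E c w \<beta> (\<lambda>x. ereal (f x))) \<and>
        (\<forall>f :: 'a \<Rightarrow> real. twice_differentiable_cont_at x0 f \<and>
           solves_star \<tau> E c w \<beta> (\<lambda>x. ereal (f x)) \<longrightarrow>
           strictly_convex_fun f \<and>
           (\<exists>A b \<gamma>. quadratic_with A b \<gamma> f \<and> star_coefficients \<tau> E c w \<beta> A b \<gamma>))"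
    if hyp: "positive_definite E \<and> (\<exists>B :: 'a set. finite B \<and> span B = UNIV) \<and> \<tau> \<noteq> 1"
  proof -
    have E: "positive_definite E" and tau1: "\<tau> \<noteq> 1" using hyp by blast+
    define x0 where "x0 = (1 / (1 - \<tau>)) *\<^sub>R (inv (blinfun_apply E) w - inv (blinfun_apply E) c)"
    obtain A b \<gamma> q where q: "quadratic_with A b \<gamma> q" "star_coefficients \<tau> E c w \<beta> A b \<gamma>"
      by (rule star_quadratic_exists[OF nontrivial E tau])
    note props = star_quadratic_properties[OF E invertible tau q]
    have uniq: "f = q"
      if "twice_differentiable_cont_at x0 f \<and> solves_star \<tau> E c w \<beta> (\<lambda>x. ereal (f x))" for f
      using star_unique_twice_differentiable[OF _ tau tau1 E invertible _ q] that
      unfolding x0_def by blast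
    have "\<exists>!f. twice_differentiable_cont_at x0 f \<and> solves_star \<tau> E c w \<beta> (\<lambda>x. ereal (f x))"
      using props(3) star_coefficients_solves_star[OF E invertible tau q] uniq
      by (intro ex1I[of _ q]) blast+
    then show ?thesis
      unfolding x0_def[symmetric] Let_def using uniq props(1) q by blast
  qed
  have sols: "solves_star 1 (- id_blinfun :: real \<Rightarrow>\<^sub>L real) 0 0 0 (\<lambda>x. ereal (skew_parabola a x))"
    if "a > 0" for a
    using that by (rule skew_parabola_solves_star)
  \<comment> \<open>Different parameters give different solutions, so the positive parameters yield
    infinitely many.\<close>
  have "inj (\<lambda>a x. ereal (skew_parabola a x))"
    using inj_skew_parabola by (simp add: inj_def fun_eq_iff)
  then have "infinite ((\<lambda>a x. ereal (skew_parabola a x)) ` {0<..})"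
    by (simp add: finite_image_iff inj_on_subset infinite_Ioi)
  moreover have "(\<lambda>a x. ereal (skew_parabola a x)) ` {0<..}
      \<subseteq> {f. solves_star 1 (- id_blinfun :: real \<Rightarrow>\<^sub>L real) 0 0 0 f}"
    using sols by auto
  ultimately have inf: "infinite {f. solves_star 1 (- id_blinfun :: real \<Rightarrow>\<^sub>L real) 0 0 0 f}"
    using infinite_super by blast
  have nonquad: "\<nexists>q. quadratic q \<and> (\<lambda>x. ereal (skew_parabola 2 x)) = (\<lambda>x. ereal (q x))"
  proof
    assume "\<exists>q. quadratic q \<and> (\<lambda>x. ereal (skew_parabola 2 x)) = (\<lambda>x. ereal (q x))"
    then obtain q where "quadratic q" "\<And>x. skew_parabola 2 x = q x"
      by (metis ereal.inject)
    then show False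
      using skew_parabola_not_quadratic by (metis ext)
  qed
  show ?thesis
  proof (intro conjI impI)
    show "\<exists>(E' :: real \<Rightarrow>\<^sub>L real) \<tau>' c' w' \<beta>'.
        bij (blinfun_apply E') \<and> \<not> positive_definite E' \<and> \<tau>' > 0 \<and>
        (\<nexists>f. solves_star \<tau>' E' c' w' \<beta>' f)"
      using blinfun_neg_id no_solution_neg_id zero_less_one by blast
    show "\<exists>(E' :: real \<Rightarrow>\<^sub>L real) \<tau>' c' w' \<beta>'.
        bij (blinfun_apply E') \<and> \<not> positive_definite E' \<and> \<tau>' > 0 \<and>
        (\<exists>f. solves_star \<tau>' E' c' w' \<beta>' f)"
      using blinfun_neg_id sols zero_less_one by blast
    show "\<exists>(E' :: real \<Rightarrow>\<^sub>L real) \<tau>' c' w' \<beta>'.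
        bij (blinfun_apply E') \<and> \<not> positive_definite E' \<and> \<tau>' > 0 \<and>
        infinite {f. solves_star \<tau>' E' c' w' \<beta>' f} \<and>
        (\<exists>f. solves_star \<tau>' E' c' w' \<beta>' f \<and>
             \<not> (\<exists>q. quadratic q \<and> f = (\<lambda>x. ereal (q x))))"
      using blinfun_neg_id inf nonquad sols[of 2] zero_less_one zero_less_numeral by blast
  qed (use a b ci cii in blast)+
qed

end
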